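(* Let $T=T_n\langle i_1,i_2;j_1,j_2\rangle$ (with $i_1<i_2$, $j_1<j_2$) be a Toeplitz matrix with $i_1+j_2=i_2+j_1=n$ and $2(i_1+j_1)\ne n$. Then the row graph of $T$ is the graph of $ST_n\langle i_1+j_1,\,n-(i_1+j_1)\rangle$, and every connected component of it is a cycle.
   Context: Write $[m]=\{1,\dots,m\}$. For disjoint subsets $\alpha=\{i_1<\cdots<i_{k_1}\}$ and $\beta=\{j_1<\cdots<j_{k_2}\}$ of $[n-1]$, not both empty, $T_n\langle\alpha;\beta\rangle=T_n\langle i_1,\ldots,i_{k_1};j_1,\ldots,j_{k_2}\rangle$ denotes the $n\times n$ $(0,1)$-matrix $(t_{u,v})$ with $t_{u,v}=1$ if and only if $u-v\in\alpha$ or $v-u\in\beta$. The row graph $\mathrm{RG}(T)$ of an $n\times n$ $(0,1)$-matrix $T=(t_{u,v})$ is the simple graph with vertex set $[n]$ in which two distinct vertices $u,v$ are adjacent if and only if $t_{u,k}=t_{v,k}=1$ for some $k\in[n]$. For a set $\gamma\subseteq[n-1]$, $ST_n\langle\gamma\rangle$ is the symmetric $n\times n$ $(0,1)$-matrix whose $(u,v)$-entry is $1$ if and only if $|u-v|\in\gamma$; its graph is the simple graph on $[n]$ having it as adjacency matrix. *)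

theory Defs
  imports "Jordan_Normal_Form.Matrix" "Graph_Theory.Graph_Theory"
begin

text \<open>
  Matrices are 0-indexed; \<open>entry1\<close> is the 1-based entry \<open>a\<^sub>u\<^sub>,\<^sub>v\<close>, to be used for
  \<open>u\<close>, \<open>v\<close> in \<open>{1..n}\<close>. The two matrix constructions below depend only on \<open>u - v\<close>,
  so they are unaffected by the shift of the indices.
\<close>

definition entry1 :: "'a mat \<Rightarrow> nat \<Rightarrow> nat \<Rightarrow> 'a" where
  "entry1 A u v = A $$ (u - 1, v - 1)"

definition toeplitz :: "nat \<Rightarrow> nat set \<Rightarrow> nat set \<Rightarrow> nat mat" where
  "toeplitz n \<alpha> \<beta> = mat n n (\<lambda>(u, v).
     if int u - int v \<in> int ` \<alpha> \<or> int v - int u \<in> int ` \<beta> then 1 else 0)"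

definition sym_toeplitz :: "nat \<Rightarrow> nat set \<Rightarrow> nat mat" where
  "sym_toeplitz n \<gamma> = mat n n (\<lambda>(u, v).
     if \<bar>int u - int v\<bar> \<in> int ` \<gamma> then 1 else 0)"

text \<open>
  A simple graph is a finite, loop-free, symmetric digraph without parallel arcs
  (locale \<^locale>\<open>pair_graph\<close>): an edge \<open>{u, v}\<close> is the pair of arcs \<open>(u, v)\<close>, \<open>(v, u)\<close>.
\<close>

definition row_graph :: "nat mat \<Rightarrow> nat pair_pre_digraph" where
  "row_graph A = \<lparr> pverts = {1..dim_row A},
     parcs = {(u, v). u \<in> {1..dim_row A} \<and> v \<in> {1..dim_row A} \<and> u \<noteq> v \<and>
       (\<exists>k \<in> {1..dim_col A}. entry1 A u k = 1 \<and> entry1 A v k = 1)} \<rparr>"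

text \<open>For a symmetric \<open>(0,1)\<close>-matrix with zero diagonal, the graph with adjacency matrix \<open>A\<close>.\<close>

definition graph_of_matrix :: "nat mat \<Rightarrow> nat pair_pre_digraph" where
  "graph_of_matrix A = \<lparr> pverts = {1..dim_row A},
     parcs = {(u, v). u \<in> {1..dim_row A} \<and> v \<in> {1..dim_row A} \<and> entry1 A u v = 1} \<rparr>"

definition cycle_graph :: "nat \<Rightarrow> nat pair_pre_digraph" where
  "cycle_graph m = \<lparr> pverts = {0..<m},
     parcs = {(i, j). i < m \<and> j < m \<and> (j = (i + 1) mod m \<or> i = (j + 1) mod m)} \<rparr>"

text \<open>
  The length is at least 3. (The predicate \<^const>\<open>pre_digraph.cycle\<close> is about closed walks and
  also accepts \<open>u, v, u\<close> in a symmetric digraph, so it is not used here.)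
\<close>

definition is_cycle_graph :: "('a, 'b) pre_digraph \<Rightarrow> bool" where
  "is_cycle_graph H \<longleftrightarrow> (\<exists>m\<ge>3. digraph_iso H (with_proj (cycle_graph m)))"

text \<open>The qualified name avoids the topological constant \<open>connected\<close>.\<close>

definition connected_component_of ::
    "('a, 'b) pre_digraph \<Rightarrow> ('a, 'b) pre_digraph \<Rightarrow> bool" where
  "connected_component_of G H \<longleftrightarrow> pre_digraph.max_subgraph G Digraph_Component.connected H"

lemma pair_graphI:
  assumes fin: "finite (pverts G)"
    and wf: "\<And>u v. (u, v) \<in> parcs G \<Longrightarrow> u \<in> pverts G \<and> v \<in> pverts G \<and> u \<noteq> v"
    and sym: "\<And>u v. (u, v) \<in> parcs G \<Longrightarrow> (v, u) \<in> parcs G"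
  shows "pair_graph G"
proof -
  have "parcs G \<subseteq> pverts G \<times> pverts G"
    using wf by auto
  then have "finite (parcs G)"
    using fin by (meson finite_SigmaI finite_subset)
  moreover have "symmetric (with_proj G)"
    unfolding symmetric_def with_proj_simps by (rule symI) (rule sym)
  moreover have "fst e \<in> pverts G \<and> snd e \<in> pverts G \<and> fst e \<noteq> snd e" if "e \<in> parcs G" for e
    using that wf[of "fst e" "snd e"] by simp
  ultimately show ?thesis
    using fin by unfold_locales blast+
qed

lemma pair_graph_row_graph: "pair_graph (row_graph A)"
  by (rule pair_graphI) (auto simp: row_graph_def)

lemma pair_graph_sym_toeplitz:
  assumes "0 \<notin> \<gamma>"
  shows "pair_graph (graph_of_matrix (sym_toeplitz n \<gamma>))"
proof -
  let ?G = "graph_of_matrix (sym_toeplitz n \<gamma>)"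
  have arc: "(u, v) \<in> parcs ?G \<longleftrightarrow>
      u \<in> {1..n} \<and> v \<in> {1..n} \<and> \<bar>int u - int v\<bar> \<in> int ` \<gamma>" for u v
  proof (cases "u \<in> {1..n} \<and> v \<in> {1..n}")
    case True
    then have "int (u - 1) - int (v - 1) = int u - int v" "u - 1 < n" "v - 1 < n"
      by auto
    with True show ?thesis
      by (simp add: graph_of_matrix_def sym_toeplitz_def entry1_def)
  next
    case False
    then show ?thesis
      by (auto simp: graph_of_matrix_def sym_toeplitz_def)
  qed
  have verts: "pverts ?G = {1..n}"
    by (simp add: graph_of_matrix_def sym_toeplitz_def)
  show ?thesis
  proof (rule pair_graphI)
    show "finite (pverts ?G)"
      by (simp add: verts)
    show "u \<in> pverts ?G \<and> v \<in> pverts ?G \<and> u \<noteq> v" if "(u, v) \<in> parcs ?G" for u v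
      using that assms by (auto simp: arc verts)
    show "(v, u) \<in> parcs ?G" if "(u, v) \<in> parcs ?G" for u v
      using that by (simp add: arc abs_minus_commute)
  qed
qed

lemma pair_graph_cycle_graph:
  assumes "3 \<le> m"
  shows "pair_graph (cycle_graph m)"
proof -
  have "i \<noteq> (i + 1) mod m" if "i < m" for i
    using that assms by (cases "i + 1 = m") auto
  then show ?thesis
    by (intro pair_graphI) (auto simp: cycle_graph_def)
qed

end

theory Submission
  imports Defs
begin

text \<open>
  The idea is to read indices modulo \<open>n\<close>. Put \<open>d = i\<^sub>1 + j\<^sub>1\<close>. Since \<open>j\<^sub>2 = n - i\<^sub>1\<close> and
  \<open>i\<^sub>2 = n - j\<^sub>1\<close>, the two diagonals with offsets \<open>i\<^sub>1\<close> and \<open>j\<^sub>2\<close> join up to one cyclic diagonal,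
  and so do those with offsets \<open>i\<^sub>2\<close> and \<open>j\<^sub>1\<close>. Hence row \<open>u\<close> of \<open>T\<close> has exactly two ones, in the
  columns congruent to \<open>u - i\<^sub>1\<close> and \<open>u + j\<^sub>1\<close>
  (\<open>entry1_toeplitz_complementary\<close>). Two different rows \<open>u\<close>, \<open>v\<close> can then share a one only
  if \<open>u - i\<^sub>1\<close> is congruent to \<open>v + j\<^sub>1\<close> or the other way round, that is, if \<open>v\<close> and \<open>u\<close> differ
  by \<open>d\<close> modulo \<open>n\<close>. For numbers between \<open>1\<close> and \<open>n\<close> this is the condition that
  \<open>\<bar>u - v\<bar>\<close> is \<open>d\<close> or \<open>n - d\<close>, which defines the symmetric Toeplitz matrix.

  Both graphs therefore arise from one permutation, the rotation of \<open>{1..n}\<close> by \<open>d\<close>, by joining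
  every point to its image. For any permutation the components of such a graph are
  induced on its orbits, and an orbit with at least three points, listed as
  \<open>u, \<sigma> u, \<sigma> (\<sigma> u), \<dots>\<close>, carries a cycle
  (\<open>connected_component_perm_graph_is_cycle\<close>). The rotation has no fixed points
  because \<open>0 < d < n\<close>, and no orbits of two points because \<open>2 * d \<noteq> n\<close>.
\<close>

section \<open>Connected components of symmetric digraphs\<close>

text \<open>
  Maximality among all connected subgraphs, induced or not, is what makes \<open>H\<close> as a whole
  determined by one of its vertices: everything in \<open>H\<close> is reachable from \<open>u\<close>, so \<open>H\<close> lies inside
  the subgraph induced on the reachable vertices, and that subgraph is itself connected.
\<close>

lemma (in sym_digraph) connected_component_eq_induce_reachable:
  assumes comp: "connected_component_of G H" and u: "u \<in> verts H"
  shows "H = G \<restriction> {v. u \<rightarrow>\<^sup>* v}"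
proof -
  let ?K = "G \<restriction> {v. u \<rightarrow>\<^sup>* v}"
  have sub: "subgraph H G" and conn: "Digraph_Component.connected H"
    and maximal: "\<And>H'. subgraph H H' \<Longrightarrow> subgraph H' G \<Longrightarrow> Digraph_Component.connected H' \<Longrightarrow> H' = H"
    using comp by (auto simp: connected_component_of_def max_subgraph_def)
  have uG: "u \<in> verts G"
    using sub u by (auto simp: subgraph_def)
  have reach: "u \<rightarrow>\<^sup>* v" if "v \<in> verts H" for v
  proof -
    have "u \<rightarrow>\<^sup>*\<^bsub>mk_symmetric H\<^esub> v"
      using conn u that by (auto simp: Digraph_Component.connected_def strongly_connected_def)
    then have "u \<rightarrow>\<^sup>*\<^bsub>mk_symmetric G\<^esub> v"
      using subgraph_mk_symmetric[OF sub] by (rule pre_digraph.reachable_mono)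
    then show ?thesis
      by (simp add: reachable_mk_symmetric_eq[OF sym_arcs])
  qed
  have "?K \<in> sccs"
    using uG by (rule induce_reachable_is_in_sccs)
  then have subK: "subgraph ?K G" and "strongly_connected ?K"
    by (auto simp: sccs_def induced_subgraph_def)
  moreover have wfK: "wf_digraph ?K"
    using subK by auto
  ultimately have "Digraph_Component.connected ?K"
    by (auto simp: Digraph_Component.connected_def strongly_connected_def
        intro: wf_digraph.reachable_mk_symmetricI)
  moreover have "subgraph H ?K"
  proof (rule subgraphI)
    show "arcs H \<subseteq> arcs ?K"
    proof
      fix e assume e: "e \<in> arcs H"
      interpret H: wf_digraph H using sub by auto
      have "tail G = tail H" "head G = head H"
        using sub by (auto simp: subgraph_def compatible_def)
      then show "e \<in> arcs ?K"
        using e sub reach H.wellformed[OF e] by (auto simp: subgraph_def)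
    qed
  qed (use sub wfK reach in \<open>auto simp: subgraph_def compatible_def\<close>)
  ultimately show ?thesis
    using maximal subK by metis
qed

section \<open>The graph of a permutation\<close>

text \<open>
  The arcs of the functional graph of \<open>\<sigma>\<close>, taken in both directions. Fixed points give loops,
  and for a point of a 2-cycle the two alternatives coincide, so this is the cycle structure
  of \<open>\<sigma>\<close> drawn as a simple graph only when all orbits have at least three points.
\<close>

definition perm_graph :: "'a set \<Rightarrow> ('a \<Rightarrow> 'a) \<Rightarrow> 'a pair_pre_digraph" where
  "perm_graph V \<sigma> = \<lparr> pverts = V, parcs = {(u, v). u \<in> V \<and> v \<in> V \<and> (v = \<sigma> u \<or> u = \<sigma> v)} \<rparr>"

lemma pair_sym_digraph_perm_graph: "pair_sym_digraph (perm_graph V \<sigma>)"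
  by unfold_locales (auto simp: perm_graph_def symmetric_def intro!: symI)

text \<open>
  An edge joins a point to its image or to its preimage. Both lie in the same orbit, since the
  orbit of a permutation of a finite set is closed backwards too.
\<close>

lemma reachable_perm_graph_iff_orbit:
  assumes "finite V" "\<sigma> permutes V" "u \<in> V"
  shows "u \<rightarrow>\<^sup>*\<^bsub>with_proj (perm_graph V \<sigma>)\<^esub> v \<longleftrightarrow> v \<in> orbit \<sigma> u"
proof -
  interpret G: pair_sym_digraph "perm_graph V \<sigma>"
    by (rule pair_sym_digraph_perm_graph)
  have perm: "permutation \<sigma>"
    using assms by (auto simp: permutation_permutes)
  show ?thesis
  proof
    assume "u \<rightarrow>\<^sup>*\<^bsub>with_proj (perm_graph V \<sigma>)\<^esub> v"
    then show "v \<in> orbit \<sigma> u"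
    proof (induction rule: G.reachable_induct)
      case base
      show ?case using perm by (rule permutation_self_in_orbit)
    next
      case (step x y)
      then have "y = \<sigma> x \<or> x = \<sigma> y"
        by (auto simp: perm_graph_def)
      then show ?case
        using step.IH cyclic_on_f_in[OF assms(2) cyclic_on_orbit'[OF perm]]
        by (auto intro: orbit.step)
    qed
  next
    have adj: "(x, \<sigma> x) \<in> parcs (perm_graph V \<sigma>)" if "x \<in> V" for x
      using that permutes_in_image[OF assms(2)] by (simp add: perm_graph_def)
    assume "v \<in> orbit \<sigma> u"
    then show "u \<rightarrow>\<^sup>*\<^bsub>with_proj (perm_graph V \<sigma>)\<^esub> v"
    proof induction
      case base
      show ?case using adj[OF assms(3)] by (rule G.reachable_adjI)
    next
      case (step y)
      moreover have "y \<in> V"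
        using step.hyps permutes_orbit_subset[OF assms(2,3)] by blast
      ultimately show ?case
        using G.reachable_adj_trans[OF step.IH adj] by simp
    qed
  qed
qed

text \<open>
  The isomorphism sends \<open>k\<close> to the \<open>k\<close>-th iterate of \<open>u\<close>, for \<open>k\<close> below the period \<open>m\<close> of \<open>u\<close>. It
  turns \<open>\<sigma>\<close> into the successor modulo \<open>m\<close>. The two inequalities exclude the periods 1 and 2.
\<close>

lemma is_cycle_graph_orbit:
  assumes "finite V" "\<sigma> permutes V" "u \<in> V"
    and "\<sigma> u \<noteq> u" "\<sigma> (\<sigma> u) \<noteq> u"
  shows "is_cycle_graph (with_proj (perm_graph V \<sigma>) \<restriction> orbit \<sigma> u)"
proof -
  let ?K = "with_proj (perm_graph V \<sigma>) \<restriction> orbit \<sigma> u"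
  define m where "m = funpow_dist1 \<sigma> u u"
  define g where "g k = (\<sigma> ^^ k) u" for k
  have self: "u \<in> orbit \<sigma> u"
    using assms by (intro permutation_self_in_orbit) (auto simp: permutation_permutes)
  have gm: "g m = u" and g0: "g 0 = u"
    using funpow_dist1_prop[OF self] by (simp_all add: g_def m_def)
  have orb: "orbit \<sigma> u = g ` {0..<m}"
    using orbit_conv_funpow_dist1[OF self] by (simp add: g_def[abs_def] m_def)
  have inj: "inj_on g {0..<m}"
    using inj_on_funpow_dist1[OF self] by (simp add: g_def[abs_def] m_def)
  have sub: "orbit \<sigma> u \<subseteq> V"
    using assms by (intro permutes_orbit_subset)
  have m3: "3 \<le> m"
  proof -
    have "m \<noteq> 0" by (simp add: m_def)
    moreover have "m \<noteq> 1" "m \<noteq> 2"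
      using gm assms(4,5) by (auto simp: g_def numeral_2_eq_2)
    ultimately show ?thesis by linarith
  qed
  have succ: "\<sigma> (g k) = g ((k + 1) mod m)" if "k < m" for k
  proof (cases "k + 1 = m")
    case True
    have "\<sigma> (g k) = g (k + 1)" by (simp add: g_def)
    then show ?thesis using True gm g0 by simp
  next
    case False
    then show ?thesis using that by (simp add: g_def)
  qed
  have adj: "g j = \<sigma> (g i) \<longleftrightarrow> j = (i + 1) mod m" if "i < m" "j < m" for i j
  proof -
    have "(i + 1) mod m < m" using that by simp
    then show ?thesis
      using that inj by (auto simp: succ inj_on_eq_iff)
  qed
  interpret C: pair_graph "cycle_graph m"
    using m3 by (rule pair_graph_cycle_graph)
  define h where
    "h = \<lparr> iso_verts = g, iso_arcs = map_prod g g, iso_head = snd, iso_tail = fst \<rparr>"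
  have "parcs (cycle_graph m) \<subseteq> {0..<m} \<times> {0..<m}"
    by (auto simp: cycle_graph_def)
  then have "inj_on (map_prod g g) (parcs (cycle_graph m))"
    using map_prod_inj_on[OF inj inj] inj_on_subset by blast
  then have "pre_digraph.digraph_isomorphism (with_proj (cycle_graph m)) h"
    using inj C.wf_digraph_axioms
    by (auto simp: pre_digraph.digraph_isomorphism_def h_def cycle_graph_def)
  moreover have "?K = app_iso h (with_proj (cycle_graph m))"
  proof -
    have "arcs ?K = map_prod g g ` parcs (cycle_graph m)" (is "?L = ?R")
    proof (intro equalityI subsetI)
      fix e assume "e \<in> ?L"
      then have "fst e \<in> orbit \<sigma> u" "snd e \<in> orbit \<sigma> u"
        and e: "snd e = \<sigma> (fst e) \<or> fst e = \<sigma> (snd e)"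
        by (auto simp: perm_graph_def)
      then obtain i j where ij: "i < m" "j < m" "e = (g i, g j)"
        unfolding orb by (metis imageE atLeastLessThan_iff prod.collapse)
      then have "(i, j) \<in> parcs (cycle_graph m)"
        using e adj by (auto simp: cycle_graph_def)
      then show "e \<in> ?R" using ij by force
    next
      fix e assume "e \<in> ?R"
      then obtain i j where "i < m" "j < m" "e = (g i, g j)"
          "j = (i + 1) mod m \<or> i = (j + 1) mod m"
        by (auto simp: cycle_graph_def)
      moreover from this have "g i \<in> orbit \<sigma> u" "g j \<in> orbit \<sigma> u"
        unfolding orb by auto
      ultimately show "e \<in> ?L"
        using sub adj by (auto simp: perm_graph_def)
    qed
    then show ?thesis
      by (intro pre_digraph.equality) (simp_all add: h_def orb cycle_graph_def)
  qed
  ultimately have "digraph_iso (with_proj (cycle_graph m)) ?K"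
    by (auto simp: digraph_iso_def)
  then have "digraph_iso ?K (with_proj (cycle_graph m))"
    by (rule digraph_iso_swap[OF C.wf_digraph_axioms])
  then show ?thesis
    using m3 by (auto simp: is_cycle_graph_def)
qed

lemma connected_component_perm_graph_is_cycle:
  assumes "finite V" "\<sigma> permutes V"
    and no_short: "\<And>u. u \<in> V \<Longrightarrow> \<sigma> u \<noteq> u \<and> \<sigma> (\<sigma> u) \<noteq> u"
    and comp: "connected_component_of (with_proj (perm_graph V \<sigma>)) H"
  shows "is_cycle_graph H"
proof -
  interpret G: pair_sym_digraph "perm_graph V \<sigma>"
    by (rule pair_sym_digraph_perm_graph)
  have "subgraph H (with_proj (perm_graph V \<sigma>))" "verts H \<noteq> {}"
    using comp
    by (auto simp: connected_component_of_def pre_digraph.max_subgraph_def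
        Digraph_Component.connected_def strongly_connected_def)
  then obtain u where u: "u \<in> verts H" "u \<in> V"
    by (auto simp: subgraph_def perm_graph_def)
  have "H = with_proj (perm_graph V \<sigma>) \<restriction> orbit \<sigma> u"
    using G.connected_component_eq_induce_reachable[OF comp u(1)]
      reachable_perm_graph_iff_orbit[OF assms(1,2) u(2)] by simp
  then show ?thesis
    using is_cycle_graph_orbit[OF assms(1,2) u(2)] no_short[OF u(2)] by simp
qed

section \<open>Rotations and Toeplitz matrices\<close>

text \<open>
  Addition of \<open>d\<close> modulo \<open>n\<close> with representatives \<open>1, \<dots>, n\<close>. It is the identity elsewhere, as a
  permutation of \<open>{1..n}\<close> has to be. The case distinction, in place of a remainder, leaves
  the facts below to linear arithmetic.
\<close>

definition rotate_by :: "nat \<Rightarrow> nat \<Rightarrow> nat \<Rightarrow> nat" where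
  "rotate_by n d u = (if u \<in> {1..n} then if u + d \<le> n then u + d else u + d - n else u)"

lemma rotate_by_permutes:
  assumes "0 < d" "d < n"
  shows "rotate_by n d permutes {1..n}"
proof (rule bij_imp_permutes)
  show "bij_betw (rotate_by n d) {1..n} {1..n}"
    \<comment> \<open>the inverse rotates on by the remaining \<open>n - d\<close>\<close>
    by (rule bij_betw_byWitness[where f' = "rotate_by n (n - d)"])
      (use assms in \<open>auto simp: rotate_by_def\<close>)
qed (auto simp: rotate_by_def)

lemma rotate_by_no_short_cycle:
  assumes "0 < d" "d < n" "2 * d \<noteq> n" "u \<in> {1..n}"
  shows "rotate_by n d u \<noteq> u \<and> rotate_by n d (rotate_by n d u) \<noteq> u"
  using assms by (auto simp: rotate_by_def)

lemma rotate_by_adjacent_iff: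
  assumes "0 < d" "d < n" "u \<in> {1..n}" "v \<in> {1..n}"
  shows "v = rotate_by n d u \<or> u = rotate_by n d v \<longleftrightarrow>
    \<bar>int u - int v\<bar> \<in> int ` {d, n - d}"
  using assms by (auto simp: rotate_by_def)

lemma graph_of_sym_toeplitz_eq_perm_graph:
  assumes "0 < d" "d < n"
  shows "graph_of_matrix (sym_toeplitz n {d, n - d}) = perm_graph {1..n} (rotate_by n d)"
proof -
  have "entry1 (sym_toeplitz n {d, n - d}) u v = 1 \<longleftrightarrow>
      v = rotate_by n d u \<or> u = rotate_by n d v" if "u \<in> {1..n}" "v \<in> {1..n}" for u v
  proof -
    have "int (u - 1) - int (v - 1) = int u - int v" "u - 1 < n" "v - 1 < n"
      using that by auto
    then show ?thesis
      unfolding rotate_by_adjacent_iff[OF assms that]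
      by (simp add: sym_toeplitz_def entry1_def)
  qed
  moreover have "dim_row (sym_toeplitz n {d, n - d}) = n"
    by (simp add: sym_toeplitz_def)
  ultimately show ?thesis
    by (auto simp: graph_of_matrix_def perm_graph_def)
qed

lemma entry1_toeplitz:
  assumes "u \<in> {1..n}" "k \<in> {1..n}"
  shows "entry1 (toeplitz n \<alpha> \<beta>) u k = 1 \<longleftrightarrow> (\<exists>a\<in>\<alpha>. u = k + a) \<or> (\<exists>b\<in>\<beta>. k = u + b)"
proof -
  have diff: "int x - int y \<in> int ` A \<longleftrightarrow> (\<exists>a\<in>A. x = y + a)" for x y A
    by (auto simp: image_iff algebra_simps simp flip: of_nat_add)
  obtain u' k' where "u = Suc u'" "k = Suc k'" "u' < n" "k' < n"
    using assms by (cases u; cases k) auto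
  then show ?thesis
    by (simp add: toeplitz_def entry1_def diff)
qed

text \<open>
  A row index \<open>u\<close> equals \<open>k + i\<close> or \<open>k - (n - i)\<close> precisely when it is the rotation of \<open>k\<close> by \<open>i\<close>;
  the other two diagonals combine in the same way to \<open>k\<close> being the rotation of \<open>u\<close> by \<open>j\<close>.
\<close>

lemma entry1_toeplitz_complementary:
  assumes "i \<in> {1..n}" "j \<in> {1..n}" "i + j < n" "u \<in> {1..n}" "k \<in> {1..n}"
  shows "entry1 (toeplitz n {i, n - j} {j, n - i}) u k = 1 \<longleftrightarrow>
    u = rotate_by n i k \<or> k = rotate_by n j u"
  unfolding entry1_toeplitz[OF assms(4,5)] using assms by (auto simp: rotate_by_def)

text \<open>
  Write \<open>\<rho>\<^sub>a\<close> for the rotation by \<open>a\<close>. A common column \<open>k\<close> of distinct rows \<open>u\<close>, \<open>v\<close> cannot be of the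
  same kind for both: \<open>k\<close> determines \<open>\<rho>\<^sub>i k\<close>, and \<open>\<rho>\<^sub>j\<close> is injective. So it satisfies \<open>k = \<rho>\<^sub>j u\<close> and \<open>v = \<rho>\<^sub>i k\<close>,
  or the same with \<open>u\<close> and \<open>v\<close> exchanged, and composing the rotations eliminates \<open>k\<close>.
\<close>

lemma row_graph_toeplitz_eq_perm_graph:
  assumes "i \<in> {1..n}" "j \<in> {1..n}" "i + j < n"
  shows "row_graph (toeplitz n {i, n - j} {j, n - i}) = perm_graph {1..n} (rotate_by n (i + j))"
proof -
  let ?T = "toeplitz n {i, n - j} {j, n - i}"
  have dim: "dim_row ?T = n" "dim_col ?T = n"
    by (simp_all add: toeplitz_def)
  have "u \<noteq> v \<and> (\<exists>k\<in>{1..n}. entry1 ?T u k = 1 \<and> entry1 ?T v k = 1) \<longleftrightarrow>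
      v = rotate_by n (i + j) u \<or> u = rotate_by n (i + j) v"
    if uv: "u \<in> {1..n}" "v \<in> {1..n}" for u v
  proof -
    have in_range: "rotate_by n j w \<in> {1..n}" if "w \<in> {1..n}" for w
      using assms that by (auto simp: rotate_by_def)
    have compose: "rotate_by n i (rotate_by n j w) = rotate_by n (i + j) w"
      and moves: "rotate_by n (i + j) w \<noteq> w" if "w \<in> {1..n}" for w
      using assms that by (auto simp: rotate_by_def)
    have inj: "rotate_by n a w = rotate_by n a w' \<longleftrightarrow> w = w'" if "a \<in> {i, j}" for a w w'
      using that assms rotate_by_permutes[of a n] by (auto dest!: permutes_inj simp: inj_eq)
    have entry: "entry1 ?T w k = 1 \<longleftrightarrow> w = rotate_by n i k \<or> k = rotate_by n j w"
      if "w \<in> {1..n}" "k \<in> {1..n}" for w k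
      using assms that by (rule entry1_toeplitz_complementary)
    show ?thesis
    proof
      assume "u \<noteq> v \<and> (\<exists>k\<in>{1..n}. entry1 ?T u k = 1 \<and> entry1 ?T v k = 1)"
      then obtain k where "k \<in> {1..n}" "u \<noteq> v" "entry1 ?T u k = 1" "entry1 ?T v k = 1"
        by blast
      then show "v = rotate_by n (i + j) u \<or> u = rotate_by n (i + j) v"
        using uv entry compose inj by (metis insertCI)
    next
      assume "v = rotate_by n (i + j) u \<or> u = rotate_by n (i + j) v"
      then show "u \<noteq> v \<and> (\<exists>k\<in>{1..n}. entry1 ?T u k = 1 \<and> entry1 ?T v k = 1)"
        using uv in_range moves entry compose by metis
    qed
  qed
  then show ?thesis
    by (auto simp: row_graph_def perm_graph_def dim)
qed

theorem proposition3p12: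
  fixes n i\<^sub>1 i\<^sub>2 j\<^sub>1 j\<^sub>2 :: nat and T :: "nat mat"
  assumes "{i\<^sub>1, i\<^sub>2} \<subseteq> {1..n - 1}" and "{j\<^sub>1, j\<^sub>2} \<subseteq> {1..n - 1}"
    and "{i\<^sub>1, i\<^sub>2} \<inter> {j\<^sub>1, j\<^sub>2} = {}"
    and "i\<^sub>1 < i\<^sub>2" and "j\<^sub>1 < j\<^sub>2"
    and "T = toeplitz n {i\<^sub>1, i\<^sub>2} {j\<^sub>1, j\<^sub>2}"
    and "i\<^sub>1 + j\<^sub>2 = n" and "i\<^sub>2 + j\<^sub>1 = n"
    and "2 * (i\<^sub>1 + j\<^sub>1) \<noteq> n"
  shows "row_graph T = graph_of_matrix (sym_toeplitz n {i\<^sub>1 + j\<^sub>1, n - (i\<^sub>1 + j\<^sub>1)}) \<and>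
    (\<forall>H. connected_component_of (with_proj (row_graph T)) H \<longrightarrow> is_cycle_graph H)"
proof -
  let ?d = "i\<^sub>1 + j\<^sub>1"
  have d: "0 < ?d" "?d < n"
    using assms by auto
  have "i\<^sub>2 = n - j\<^sub>1" "j\<^sub>2 = n - i\<^sub>1"
    using assms by auto
  then have row: "row_graph T = perm_graph {1..n} (rotate_by n ?d)"
    using assms row_graph_toeplitz_eq_perm_graph[of "i\<^sub>1" n "j\<^sub>1"] d by simp
  moreover have "is_cycle_graph H"
    if "connected_component_of (with_proj (row_graph T)) H" for H
    using rotate_by_permutes[OF d] rotate_by_no_short_cycle[OF d assms(9)] that
    unfolding row by (intro connected_component_perm_graph_is_cycle[of "{1..n}"]) auto
  ultimately show ?thesis
    using graph_of_sym_toeplitz_eq_perm_graph[OF d] by simp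
qed

end
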